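(* Let $E$ be a Banach lattice with order continuous norm and let $\mathcal{T} = (T_t)_{t \in J}$ be a positive semigroup on $E$, where either $J = \mathbb{N}$ or $J = (0,\infty)$. Suppose that there exists a strictly positive functional $\psi \in E'_+$ such that $T'_t\psi \le M \psi$ for a constant $M>0$ and all $t \in J$. Assume that $\mathcal{T}$ has relatively compact orbits and suppose that for every $f \in E_+$ with $\langle \psi, f \rangle = 1$ there exists a non-zero lower bound $h_f$ for $(\mathcal{T},f)$ with respect to $\psi$ such that $\inf_{f} \langle \psi, h_f \rangle \ge 1$, where the infimum runs over all $f\in E_+$ with $\langle\psi,f\rangle=1$. Then $\mathcal{T}$ is strongly convergent as $t\to\infty$.
   Context: All spaces are real. $\mathbb{N} = \{1,2,\dots\}$. $E_+$ is the positive cone of $E$, $E'$ the dual Banach lattice, and $T'$ the adjoint of $T$. A functional $\psi \in E'$ is strictly positive if $\langle\psi,f\rangle>0$ for all $f\ge 0$, $f\neq 0$. A semigroup on $E$ is a family $(T_t)_{t \in J}$ of bounded linear operators on $E$ with $T_{t+s} = T_tT_s$ for all $s,t \in J$; no continuity in $t$ is assumed. It is positive if $T_tE_+\subseteq E_+$ for all $t \in J$. It has relatively compact orbits if for each $f\in E$ the set $\{T_tf : t\in J\}$ is relatively compact in norm. Strongly convergent means convergent in the strong operator topology to a bounded linear operator. For $\psi \in E'_+$ and $f \in E_+$, a vector $h\in E_+$ is a lower bound for $(\mathcal{T},f)$ with respect to $\psi$ if $\langle\psi,(T_tf-h)^-\rangle\to 0$ as $t\to\infty$; here $g^- = (-g)\vee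 0$. *)

theory Defs
  imports "HOL-Analysis.Analysis" "HOL-Library.Lattice_Algebras"
begin

(* The axiom of lattice_ab_group_add_abs fixes the modulus as |x| = sup x (- x). *)
class banach_lattice = banach + ordered_real_vector + lattice_ab_group_add_abs +
  assumes norm_le_if_abs_le: "\<bar>x\<bar> \<le> \<bar>y\<bar> \<Longrightarrow> norm x \<le> norm y"

(* Order continuity of the norm: every downward directed set with infimum 0 contains
   elements of arbitrarily small norm.  The first premises say that 0 is the greatest
   lower bound of D.  By monotonicity of the norm on the positive cone this is the same
   as norm convergence to 0 of every net that decreases to 0. *)
class order_continuous_banach_lattice = banach_lattice +
  assumes order_continuous_norm:
    "\<lbrakk>D \<noteq> {}; \<And>x y. x \<in> D \<Longrightarrow> y \<in> D \<Longrightarrow> \<exists>z\<in>D. z \<le> x \<and> z \<le> y;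
      \<And>x. x \<in> D \<Longrightarrow> 0 \<le> x; \<And>l. (\<And>x. x \<in> D \<Longrightarrow> l \<le> x) \<Longrightarrow> l \<le> 0; 0 < \<epsilon>\<rbrakk>
     \<Longrightarrow> \<exists>x\<in>D. norm x < \<epsilon>"

instance real :: order_continuous_banach_lattice
proof
  fix x y :: real
  assume "\<bar>x\<bar> \<le> \<bar>y\<bar>"
  then show "norm x \<le> norm y" by simp
next
  fix D :: "real set" and \<epsilon> :: real
  assume glb: "\<And>l. (\<And>x. x \<in> D \<Longrightarrow> l \<le> x) \<Longrightarrow> l \<le> 0"
    and nonneg: "\<And>x. x \<in> D \<Longrightarrow> 0 \<le> x" and "0 < \<epsilon>"
  show "\<exists>x\<in>D. norm x < \<epsilon>"
  proof (rule ccontr)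
    assume "\<not> (\<exists>x\<in>D. norm x < \<epsilon>)"
    with nonneg have "\<And>x. x \<in> D \<Longrightarrow> \<epsilon> \<le> x" by (metis abs_of_nonneg not_less real_norm_def)
    with glb \<open>0 < \<epsilon>\<close> show False by (metis not_less)
  qed
qed

(* The library puts no order on bounded linear functions; this is the dual lattice order. *)
definition dual_le ::
    "('a::banach_lattice \<Rightarrow>\<^sub>L real) \<Rightarrow> ('a \<Rightarrow>\<^sub>L real) \<Rightarrow> bool" where
  "dual_le \<phi> \<eta> \<longleftrightarrow> (\<forall>f\<ge>0. blinfun_apply \<phi> f \<le> blinfun_apply \<eta> f)"

definition strictly_positive :: "('a::banach_lattice \<Rightarrow>\<^sub>L real) \<Rightarrow> bool" where
  "strictly_positive \<psi> \<longleftrightarrow> (\<forall>f\<ge>0. f \<noteq> 0 \<longrightarrow> blinfun_apply \<psi> f > 0)"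

definition dual_op ::
    "('a::real_normed_vector \<Rightarrow>\<^sub>L 'a) \<Rightarrow> ('a \<Rightarrow>\<^sub>L real) \<Rightarrow> ('a \<Rightarrow>\<^sub>L real)" where
  "dual_op S \<phi> = \<phi> o\<^sub>L S"

definition neg_part :: "'a::banach_lattice \<Rightarrow> 'a" where
  "neg_part g = sup (- g) 0"

(* In the following, T is a family indexed by J; its values outside J are irrelevant. *)

definition semigroup_on ::
    "real set \<Rightarrow> (real \<Rightarrow> 'a::real_normed_vector \<Rightarrow>\<^sub>L 'a) \<Rightarrow> bool" where
  "semigroup_on J T \<longleftrightarrow> (\<forall>s\<in>J. \<forall>t\<in>J. T (t + s) = T t o\<^sub>L T s)"

definition positive_on ::
    "real set \<Rightarrow> (real \<Rightarrow> 'a::banach_lattice \<Rightarrow>\<^sub>L 'a) \<Rightarrow> bool" where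
  "positive_on J T \<longleftrightarrow> (\<forall>t\<in>J. \<forall>f\<ge>0. 0 \<le> blinfun_apply (T t) f)"

definition relatively_compact_orbits ::
    "real set \<Rightarrow> (real \<Rightarrow> 'a::real_normed_vector \<Rightarrow>\<^sub>L 'a) \<Rightarrow> bool" where
  "relatively_compact_orbits J T \<longleftrightarrow>
     (\<forall>f. compact (closure ((\<lambda>t. blinfun_apply (T t) f) ` J)))"

definition at_top_in :: "real set \<Rightarrow> real filter" where
  "at_top_in J = inf at_top (principal J)"

definition strongly_convergent_on ::
    "real set \<Rightarrow> (real \<Rightarrow> 'a::real_normed_vector \<Rightarrow>\<^sub>L 'a) \<Rightarrow> bool" where
  "strongly_convergent_on J T \<longleftrightarrow>
     (\<exists>S :: 'a \<Rightarrow>\<^sub>L 'a. \<forall>f.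
        ((\<lambda>t. blinfun_apply (T t) f) \<longlongrightarrow> blinfun_apply S f) (at_top_in J))"

definition lower_bound_wrt ::
    "real set \<Rightarrow> (real \<Rightarrow> 'a::banach_lattice \<Rightarrow>\<^sub>L 'a) \<Rightarrow> ('a \<Rightarrow>\<^sub>L real) \<Rightarrow> 'a \<Rightarrow> 'a \<Rightarrow> bool" where
  "lower_bound_wrt J T \<psi> f h \<longleftrightarrow>
     0 \<le> h \<and>
     ((\<lambda>t. blinfun_apply \<psi> (neg_part (blinfun_apply (T t) f - h))) \<longlongrightarrow> 0) (at_top_in J)"

end

theory Submission
  imports Defs
begin

text \<open>The proof rests on the norm \<open>p x = \<psi> \<bar>x\<bar>\<close>, which is weaker than the given one and for which
  every \<open>T t\<close> has norm at most \<open>M\<close>.  On a compact set both norms define the same topology, so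
  along an orbit it suffices to prove convergence with respect to \<open>p\<close>.

  For \<open>f \<ge> 0\<close> the orbit closure \<open>K\<close> is compact, so \<open>\<psi>\<close> attains its maximum on \<open>K\<close> at some \<open>g\<close>.
  Rescaling the lower bounds gives a lower bound \<open>k\<close> for \<open>g\<close> with \<open>\<psi> k \<ge> \<psi> g\<close>, while
  \<open>\<psi> (T t g) \<le> \<psi> g\<close> because \<open>K\<close> is invariant.  So \<open>T t g\<close> lies asymptotically above \<open>k\<close> but has
  no more mass than \<open>k\<close>, which forces \<open>p (T t g - k) \<rightarrow> 0\<close>.  The limit \<open>k\<close> is a fixed point.  The
  orbit of \<open>f\<close> comes close to \<open>g\<close>, hence close to \<open>k\<close>, and from then on it stays close to the fixed
  point \<open>k\<close> (lemma \<open>orbit_convergent\<close>).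

  Splitting a vector into positive and negative part yields convergence of every orbit.  The
  pointwise limit is a positive linear map, and such maps between Banach lattices are
  automatically bounded (lemma \<open>bounded_linear_if_positive\<close>).\<close>


section \<open>Banach lattices\<close>

lemma norm_abs_eq: "norm \<bar>x\<bar> = norm (x::'a::banach_lattice)"
  by (intro antisym norm_le_if_abs_le) simp_all

lemma norm_le_if_pos_le:
  fixes x y :: "'a::banach_lattice"
  assumes "0 \<le> x" and "x \<le> y"
  shows "norm x \<le> norm y"
proof -
  have "0 \<le> y"
    using assms by (rule order_trans)
  with assms show ?thesis
    by (intro norm_le_if_abs_le) simp
qed

lemma continuous_on_abs_banach_lattice:
  "continuous_on A (abs :: 'a::banach_lattice \<Rightarrow> 'a)"
proof -
  have "norm (\<bar>x\<bar> - \<bar>y\<bar>) \<le> norm (x - y)" for x y :: 'a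
    by (intro norm_le_if_abs_le abs_triangle_ineq3)
  then have "1-lipschitz_on A (abs :: 'a \<Rightarrow> 'a)"
    by (intro lipschitz_onI) (simp_all add: dist_norm)
  then show ?thesis
    by (rule lipschitz_on_continuous_on)
qed

text \<open>The cone is the fixed point set of the continuous map \<open>abs\<close>.\<close>

lemma closed_positive_cone: "closed {x::'a::banach_lattice. 0 \<le> x}"
proof -
  have "{x::'a. 0 \<le> x} = {x. \<bar>x\<bar> = x}"
    by (auto simp: abs_of_nonneg) (metis abs_ge_zero)
  moreover have "closed {x::'a. \<bar>x\<bar> = x}"
    by (intro closed_Collect_eq continuous_on_abs_banach_lattice continuous_on_id)
  ultimately show ?thesis
    by simp
qed

lemma abs_scaleR_nonneg_le:
  fixes x :: "'a::banach_lattice"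
  assumes "0 \<le> c"
  shows "\<bar>c *\<^sub>R x\<bar> \<le> c *\<^sub>R \<bar>x\<bar>"
proof (rule abs_leI)
  show "c *\<^sub>R x \<le> c *\<^sub>R \<bar>x\<bar>"
    using assms by (intro scaleR_left_mono abs_ge_self)
  have "c *\<^sub>R (- x) \<le> c *\<^sub>R \<bar>x\<bar>"
    using assms by (intro scaleR_left_mono abs_ge_minus_self)
  then show "- (c *\<^sub>R x) \<le> c *\<^sub>R \<bar>x\<bar>"
    by simp
qed

lemma abs_eq_plus_neg_part: "\<bar>x\<bar> = x + 2 *\<^sub>R neg_part (x::'a::banach_lattice)"
proof -
  have "\<bar>x\<bar> = pprt x - nprt x"
    by (rule abs_prts)
  also have "\<dots> = (pprt x + nprt x) + 2 *\<^sub>R (- nprt x)"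
    by (simp add: scaleR_2)
  also have "pprt x + nprt x = x"
    by (rule prts[symmetric])
  also have "- nprt x = neg_part x"
    unfolding neg_part_def pprt_def[symmetric] by (rule pprt_neg[symmetric])
  finally show ?thesis .
qed

text \<open>If the operator were unbounded, there would be positive unit vectors \<open>y n\<close> with
  \<open>norm (S (y n))\<close> growing faster than \<open>2 ^ n\<close>.  The vector \<open>\<Sum>n. y n / 2 ^ n\<close> dominates each
  of its terms, so its image would have norm larger than every \<open>n\<close>.\<close>

lemma bounded_linear_if_positive:
  fixes S :: "'a::banach_lattice \<Rightarrow> 'b::banach_lattice"
  assumes lin: "linear S" and pos: "\<And>x. 0 \<le> x \<Longrightarrow> 0 \<le> S x"
  shows "bounded_linear S"
proof (rule ccontr)
  interpret linear S by (rule lin)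
  have mono: "S x \<le> S y" if "x \<le> y" for x y
    using pos[of "y - x"] that by (simp add: diff)
  have abs_le: "norm (S x) \<le> norm (S \<bar>x\<bar>)" for x
  proof (rule norm_le_if_abs_le)
    have "\<bar>S x\<bar> \<le> S \<bar>x\<bar>"
      using mono[OF abs_ge_self[of x]] mono[OF abs_ge_minus_self[of x]]
      by (intro abs_leI) (simp_all add: neg)
    then show "\<bar>S x\<bar> \<le> \<bar>S \<bar>x\<bar>\<bar>"
      by (simp add: pos)
  qed
  assume "\<not> bounded_linear S"
  then have "\<forall>K. \<exists>x. norm x * K < norm (S x)"
    using lin by (auto simp: bounded_linear_def bounded_linear_axioms_def not_le)
  then have "\<forall>n::nat. \<exists>x. norm x * (n * 2 ^ n) < norm (S x)"
    by blast
  then obtain x where x: "\<And>n::nat. norm (x n) * (n * 2 ^ n) < norm (S (x n))"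
    by metis
  define y where "y n = (1 / norm (x n)) *\<^sub>R \<bar>x n\<bar>" for n
  have x0: "norm (x n) > 0" for n
    using x[of n] zero by (cases "x n = 0") auto
  have y0: "0 \<le> y n" for n
    by (simp add: y_def scaleR_nonneg_nonneg)
  have normy: "norm (y n) = 1" for n
    using x0[of n] by (simp add: y_def norm_abs_eq)
  have large: "n * 2 ^ n < norm (S (y n))" for n
  proof -
    have "norm (x n) * (n * 2 ^ n) < norm (S \<bar>x n\<bar>)"
      using x[of n] abs_le[of "x n"] by linarith
    then show ?thesis
      using x0[of n] by (simp add: y_def scale field_simps)
  qed
  define z where "z n = (1 / 2 ^ n) *\<^sub>R y n" for n
  have z0: "0 \<le> z n" for n
    by (simp add: z_def y0 scaleR_nonneg_nonneg)
  have "summable z"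
  proof (rule summable_comparison_test')
    show "summable (\<lambda>n. (1 / 2 :: real) ^ n)"
      by (simp add: summable_geometric)
    show "norm (z n) \<le> (1 / 2) ^ n" if "n \<ge> 0" for n
      by (simp add: z_def normy power_divide)
  qed
  then have lim: "(\<lambda>N. \<Sum>n<N. z n) \<longlonglongrightarrow> suminf z"
    by (rule summable_LIMSEQ)
  have dom: "z n \<le> suminf z" for n
  proof -
    have "suminf z - z n \<in> {x. 0 \<le> x}"
    proof (rule Lim_in_closed_set[OF closed_positive_cone])
      show "(\<lambda>N. (\<Sum>n<N. z n) - z n) \<longlonglongrightarrow> suminf z - z n"
        by (intro tendsto_intros lim)
      show "\<forall>\<^sub>F N in sequentially. (\<Sum>n<N. z n) - z n \<in> {x. 0 \<le> x}"
        using eventually_gt_at_top[of n]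
      proof eventually_elim
        case (elim N)
        have "(\<Sum>n<N. z n) = z n + (\<Sum>n\<in>{..<N} - {n}. z n)"
          using elim by (intro sum.remove) auto
        moreover have "0 \<le> (\<Sum>n\<in>{..<N} - {n}. z n)"
          by (intro sum_nonneg z0)
        ultimately show ?case
          by simp
      qed
    qed simp
    then show ?thesis
      by simp
  qed
  have "real n < norm (S (suminf z))" for n
  proof -
    have "real n < norm (S (z n))"
      using large[of n] by (simp add: z_def scale field_simps)
    also have "\<dots> \<le> norm (S (suminf z))"
      by (intro norm_le_if_pos_le pos mono dom z0)
    finally show ?thesis .
  qed
  then show False
    using reals_Archimedean2[of "norm (S (suminf z))"] less_asym by blast
qed


section \<open>The norm induced by a strictly positive functional\<close>

definition abs_functional :: "('a::banach_lattice \<Rightarrow>\<^sub>L real) \<Rightarrow> 'a \<Rightarrow> real" where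
  "abs_functional \<psi> x = blinfun_apply \<psi> \<bar>x\<bar>"

lemma strictly_positive_nonneg:
  "strictly_positive \<psi> \<Longrightarrow> 0 \<le> x \<Longrightarrow> 0 \<le> blinfun_apply \<psi> x"
  unfolding strictly_positive_def by (cases "x = 0") (auto intro: less_imp_le)

lemma strictly_positive_mono:
  assumes "strictly_positive \<psi>" and "x \<le> y"
  shows "blinfun_apply \<psi> x \<le> blinfun_apply \<psi> y"
  using strictly_positive_nonneg[OF assms(1), of "y - x"] assms(2)
  by (simp add: blinfun.diff_right)

lemma abs_functional_nonneg: "strictly_positive \<psi> \<Longrightarrow> 0 \<le> abs_functional \<psi> x"
  unfolding abs_functional_def by (intro strictly_positive_nonneg) simp_all

lemma abs_functional_pos: "strictly_positive \<psi> \<Longrightarrow> x \<noteq> 0 \<Longrightarrow> 0 < abs_functional \<psi> x"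
  unfolding abs_functional_def strictly_positive_def by simp

lemma abs_functional_triangle:
  assumes "strictly_positive \<psi>"
  shows "abs_functional \<psi> (x + y) \<le> abs_functional \<psi> x + abs_functional \<psi> y"
  using strictly_positive_mono[OF assms abs_triangle_ineq[of x y]]
  by (simp add: abs_functional_def blinfun.add_right)

lemma abs_functional_diff_commute: "abs_functional \<psi> (x - y) = abs_functional \<psi> (y - x)"
  by (simp add: abs_functional_def abs_minus_commute)

lemma continuous_on_abs_functional:
  assumes "continuous_on A g"
  shows "continuous_on A (\<lambda>x. abs_functional \<psi> (g x))"
  unfolding abs_functional_def
  by (intro continuous_intros
      continuous_on_compose2[OF continuous_on_abs_banach_lattice[of UNIV] assms] subset_UNIV)

text \<open>For a positive operator \<open>A\<close> one has \<open>\<bar>A x\<bar> \<le> A \<bar>x\<bar>\<close>, so an estimate for \<open>\<psi>\<close> on the cone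
  becomes one for the induced norm.\<close>

lemma abs_functional_positive_operator:
  assumes \<psi>: "strictly_positive \<psi>" and A: "\<And>x. 0 \<le> x \<Longrightarrow> 0 \<le> blinfun_apply A x"
    and M: "dual_le (dual_op A \<psi>) (M *\<^sub>R \<psi>)"
  shows "abs_functional \<psi> (A x) \<le> M * abs_functional \<psi> x"
proof -
  have mono: "A y \<le> A z" if "y \<le> z" for y z
    using A[of "z - y"] that by (simp add: blinfun.diff_right)
  have "\<bar>A x\<bar> \<le> A \<bar>x\<bar>"
    using mono[OF abs_ge_self[of x]] mono[OF abs_ge_minus_self[of x]]
    by (intro abs_leI) (simp_all add: blinfun.minus_right)
  then have "\<psi> \<bar>A x\<bar> \<le> \<psi> (A \<bar>x\<bar>)"
    by (rule strictly_positive_mono[OF \<psi>])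
  also have "\<dots> \<le> M * \<psi> \<bar>x\<bar>"
    using M by (simp add: dual_le_def dual_op_def scaleR_blinfun.rep_eq)
  finally show ?thesis
    by (simp add: abs_functional_def)
qed

text \<open>Off every open neighbourhood of \<open>k\<close> the continuous function \<open>q\<close> is bounded away from \<open>0\<close> on the
  compact set \<open>K\<close>.\<close>

lemma tendsto_if_compact_and_separating:
  fixes x :: "'b \<Rightarrow> 'a::t2_space" and q :: "'a \<Rightarrow> real"
  assumes K: "compact K" "\<forall>\<^sub>F t in F. x t \<in> K"
    and q: "continuous_on K q" "\<And>y. y \<in> K \<Longrightarrow> y \<noteq> k \<Longrightarrow> 0 < q y"
    and lim: "((\<lambda>t. q (x t)) \<longlongrightarrow> 0) F"
  shows "(x \<longlongrightarrow> k) F"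
proof (rule topological_tendstoI)
  fix U assume U: "open U" "k \<in> U"
  show "\<forall>\<^sub>F t in F. x t \<in> U"
  proof (cases "K - U = {}")
    case True
    with K(2) show ?thesis
      by (auto elim!: eventually_mono)
  next
    case False
    have "compact (K - U)"
      using K(1) U(1) by (rule compact_diff)
    moreover have "continuous_on (K - U) q"
      using q(1) by (rule continuous_on_subset) auto
    ultimately obtain m where m: "m \<in> K - U" "\<forall>y\<in>K - U. q m \<le> q y"
      using False continuous_attains_inf by blast
    have "0 < q m"
      using m(1) U(2) by (intro q(2)) auto
    then have "\<forall>\<^sub>F t in F. q (x t) < q m"
      using lim by (intro order_tendstoD)
    with K(2) show ?thesis
      by eventually_elim (use m(2) in force)
  qed
qed


section \<open>Convergence of the orbits\<close>

lemma eventually_at_top_in: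
  "eventually P (at_top_in J) \<longleftrightarrow> (\<exists>N. \<forall>t\<ge>N. t \<in> J \<longrightarrow> P t)"
  by (simp add: at_top_in_def eventually_inf_principal eventually_at_top_linorder)

text \<open>Both parts of \<open>T t g - h\<close> vanish asymptotically: the negative part because \<open>h\<close> is a lower
  bound, and then the positive part because \<open>T t g\<close> has no more mass than \<open>h\<close>.\<close>

lemma abs_functional_tendsto_0_if_lower_bound:
  assumes \<psi>: "strictly_positive \<psi>"
    and h: "lower_bound_wrt J T \<psi> g h"
    and le: "\<And>t. t \<in> J \<Longrightarrow> \<psi> (T t g) \<le> \<psi> h"
  shows "((\<lambda>t. abs_functional \<psi> (T t g - h)) \<longlongrightarrow> 0) (at_top_in J)"
proof (rule tendsto_sandwich)
  show "\<forall>\<^sub>F t in at_top_in J. 0 \<le> abs_functional \<psi> (T t g - h)"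
    by (intro always_eventually allI abs_functional_nonneg \<psi>)
  show "\<forall>\<^sub>F t in at_top_in J.
      abs_functional \<psi> (T t g - h) \<le> 2 * \<psi> (neg_part (T t g - h))"
    unfolding eventually_at_top_in
  proof (intro exI allI impI)
    fix t assume "t \<in> J"
    have "abs_functional \<psi> (T t g - h) = \<psi> (T t g) - \<psi> h + 2 * \<psi> (neg_part (T t g - h))"
      unfolding abs_functional_def
      by (subst abs_eq_plus_neg_part)
         (simp only: blinfun.add_right blinfun.scaleR_right blinfun.diff_right real_scaleR_def)
    then show "abs_functional \<psi> (T t g - h) \<le> 2 * \<psi> (neg_part (T t g - h))"
      using le[OF \<open>t \<in> J\<close>] by simp
  qed
  show "((\<lambda>t. 2 * \<psi> (neg_part (T t g - h))) \<longlongrightarrow> 0) (at_top_in J)"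
    using h tendsto_mult_right_zero unfolding lower_bound_wrt_def by blast
qed simp

text \<open>The first three hypotheses cover discrete and continuous time simultaneously.  In the proof \<open>g\<close> is a point of the orbit closure \<open>K\<close> at
  which \<open>\<psi>\<close> is maximal: such a point cannot gain mass under the semigroup, whereas its lower bound
  has at least as much mass.\<close>

lemma orbit_convergent:
  fixes T :: "real \<Rightarrow> 'a::banach_lattice \<Rightarrow>\<^sub>L 'a"
  assumes add: "\<And>s t. s \<in> J \<Longrightarrow> t \<in> J \<Longrightarrow> s + t \<in> J"
    and shift: "\<And>s t. s \<in> J \<Longrightarrow> t \<in> J \<Longrightarrow> s < t \<Longrightarrow> t - s \<in> J"
    and unbounded: "\<And>N. \<exists>t\<in>J. N \<le> t"
    and sg: "semigroup_on J T" and pos: "positive_on J T"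
    and \<psi>: "strictly_positive \<psi>"
    and M: "0 < M" "\<And>t. t \<in> J \<Longrightarrow> dual_le (dual_op (T t) \<psi>) (M *\<^sub>R \<psi>)"
    and comp: "relatively_compact_orbits J T"
    and lower: "\<And>f. 0 \<le> f \<Longrightarrow> \<psi> f = 1 \<Longrightarrow> \<exists>h. lower_bound_wrt J T \<psi> f h \<and> 1 \<le> \<psi> h"
    and f: "0 \<le> f"
  shows "\<exists>k. ((\<lambda>t. T t f) \<longlongrightarrow> k) (at_top_in J)"
proof -
  let ?p = "abs_functional \<psi>"
  define K where "K = closure ((\<lambda>t. T t f) ` J)"
  have sgD: "T (t + s) x = T t (T s x)" if "s \<in> J" "t \<in> J" for s t x
    using sg that by (simp add: semigroup_on_def)
  have contr: "?p (T t x) \<le> M * ?p x" if "t \<in> J" for t x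
    using pos that by (intro abs_functional_positive_operator \<psi> M(2)) (auto simp: positive_on_def)
  have K: "compact K" "K \<noteq> {}"
    using comp unbounded[of 0] by (auto simp: K_def relatively_compact_orbits_def)
  have K_inv: "T t x \<in> K" if "t \<in> J" "x \<in> K" for t x
  proof -
    have "T t ` K \<subseteq> K"
      unfolding K_def
    proof (rule image_closure_subset)
      show "continuous_on (closure ((\<lambda>t. T t f) ` J)) (T t)"
        by (intro continuous_intros)
      show "T t ` (\<lambda>t. T t f) ` J \<subseteq> closure ((\<lambda>t. T t f) ` J)"
        using add that(1) closure_subset[of "(\<lambda>t. T t f) ` J"] by (force simp flip: sgD)
    qed simp
    with that show ?thesis
      by auto
  qed
  have K_pos: "0 \<le> x" if "x \<in> K" for x
  proof -
    have "K \<subseteq> {x. 0 \<le> x}"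
      unfolding K_def using pos f
      by (intro closure_minimal closed_positive_cone) (auto simp: positive_on_def)
    with that show ?thesis
      by auto
  qed
  obtain g where g: "g \<in> K" "\<And>x. x \<in> K \<Longrightarrow> \<psi> x \<le> \<psi> g"
    using continuous_attains_sup[OF K linear_continuous_on[OF blinfun.bounded_linear_right]]
    by blast
  have "\<exists>k. ((\<lambda>t. ?p (T t g - k)) \<longlongrightarrow> 0) (at_top_in J)"
  proof (cases "g = 0")
    case True
    then show ?thesis
      by (intro exI[of _ 0]) (simp add: abs_functional_def blinfun.zero_right)
  next
    case False
    define c where "c = \<psi> g"
    have c: "0 < c"
      using \<psi> K_pos[OF g(1)] False by (auto simp: c_def strictly_positive_def)
    \<comment> \<open>Lower bounds are given for vectors of mass \<open>1\<close> only, hence the rescaling.\<close>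
    have "\<exists>h. lower_bound_wrt J T \<psi> ((1 / c) *\<^sub>R g) h \<and> 1 \<le> \<psi> h"
      using c K_pos[OF g(1)]
      by (intro lower) (simp_all add: scaleR_nonneg_nonneg blinfun.scaleR_right c_def)
    then obtain h where h: "lower_bound_wrt J T \<psi> ((1 / c) *\<^sub>R g) h" "1 \<le> \<psi> h"
      by blast
    have "((\<lambda>t. ?p (T t ((1 / c) *\<^sub>R g) - h)) \<longlongrightarrow> 0) (at_top_in J)"
    proof (rule abs_functional_tendsto_0_if_lower_bound[OF \<psi> h(1)])
      fix t assume "t \<in> J"
      then have "\<psi> (T t g) \<le> c"
        unfolding c_def by (intro g K_inv)
      then have "\<psi> (T t ((1 / c) *\<^sub>R g)) \<le> 1"
        using c by (simp add: blinfun.scaleR_right)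
      with h(2) show "\<psi> (T t ((1 / c) *\<^sub>R g)) \<le> \<psi> h"
        by linarith
    qed
    then have *: "((\<lambda>t. c * ?p (T t ((1 / c) *\<^sub>R g) - h)) \<longlongrightarrow> 0) (at_top_in J)"
      by (rule tendsto_mult_right_zero)
    have "?p (T t g - c *\<^sub>R h) \<le> c * ?p (T t ((1 / c) *\<^sub>R g) - h)" for t
    proof -
      have "T t g - c *\<^sub>R h = c *\<^sub>R (T t ((1 / c) *\<^sub>R g) - h)"
        using c by (simp add: blinfun.scaleR_right scaleR_diff_right)
      then show ?thesis
        using strictly_positive_mono[OF \<psi> abs_scaleR_nonneg_le[of c]] c
        by (simp add: abs_functional_def blinfun.scaleR_right)
    qed
    with * have "((\<lambda>t. ?p (T t g - c *\<^sub>R h)) \<longlongrightarrow> 0) (at_top_in J)"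
      by (intro tendsto_sandwich[OF _ _ tendsto_const *])
         (simp_all add: abs_functional_nonneg \<psi>)
    then show ?thesis
      by blast
  qed
  then obtain k where k: "((\<lambda>t. ?p (T t g - k)) \<longlongrightarrow> 0) (at_top_in J)"
    by blast
  have near: "\<exists>N. \<forall>t\<ge>N. t \<in> J \<longrightarrow> ?p (T t g - k) < e" if "0 < e" for e
    using order_tendstoD(2)[OF k that] by (simp add: eventually_at_top_in)
  have tri: "?p (x - z) \<le> ?p (x - y) + ?p (y - z)" for x y z
    using abs_functional_triangle[OF \<psi>, of "x - y" "y - z"] by simp
  \<comment> \<open>\<open>T t g\<close> and its shift \<open>T (s + t) g\<close> have the same limit, and \<open>T s\<close> is \<open>p\<close>-continuous.\<close>
  have fix_k: "T s k = k" if s: "s \<in> J" for s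
  proof (rule ccontr)
    assume "T s k \<noteq> k"
    then have d: "0 < ?p (T s k - k)"
      by (intro abs_functional_pos \<psi>) simp
    \<comment> \<open>The tolerance is chosen such that \<open>M * e + e\<close> is exactly the positive quantity to be refuted.\<close>
    define e where "e = ?p (T s k - k) / (M + 1)"
    have e: "0 < e"
      using d M(1) by (simp add: e_def)
    obtain N where N: "\<forall>t\<ge>N. t \<in> J \<longrightarrow> ?p (T t g - k) < e"
      using near[OF e] by blast
    obtain t where t: "t \<in> J" "max N (N - s) \<le> t"
      using unbounded by blast
    have "?p (T s k - k) \<le> ?p (T s k - T (s + t) g) + ?p (T (s + t) g - k)"
      by (rule tri)
    also have "T s k - T (s + t) g = T s (k - T t g)"
      by (simp add: sgD s t blinfun.diff_right)
    also have "?p (T s (k - T t g)) \<le> M * ?p (T t g - k)"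
      using contr[OF s] abs_functional_diff_commute by metis
    also have "\<dots> < M * e"
      using N t M(1) by simp
    also have "?p (T (s + t) g - k) < e"
      using N t add[OF s t(1)] by simp
    finally have "?p (T s k - k) < M * e + e"
      by simp
    also have "M * e + e = (M + 1) * e"
      by (simp add: distrib_right)
    also have "\<dots> = ?p (T s k - k)"
      using M(1) by (simp add: e_def)
    finally show False
      by simp
  qed
  have "((\<lambda>t. ?p (T t f - k)) \<longlongrightarrow> 0) (at_top_in J)"
  proof (rule order_tendstoI)
    fix a :: real assume "a < 0"
    then show "\<forall>\<^sub>F t in at_top_in J. a < ?p (T t f - k)"
      using abs_functional_nonneg[OF \<psi>] by (intro always_eventually allI) (rule less_le_trans)
  next
    fix e :: real assume e: "0 < e"
    obtain s where s: "s \<in> J" "?p (T s g - k) < e / M"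
      using near[of "e / M"] e M(1) unbounded by (metis divide_pos_pos)
    \<comment> \<open>\<open>T s\<close> brings \<open>g\<close> near \<open>k\<close>, hence also an orbit point \<open>T r f\<close> that is close enough to \<open>g\<close>.\<close>
    have "open {x. ?p (T s x - k) < e / M}" (is "open ?U")
      by (intro open_Collect_less continuous_on_abs_functional continuous_intros)
    moreover have "g \<in> ?U \<inter> closure ((\<lambda>t. T t f) ` J)"
      using g(1) s(2) by (simp add: K_def)
    ultimately have "?U \<inter> (\<lambda>t. T t f) ` J \<noteq> {}"
      using open_Int_closure_eq_empty by blast
    then obtain r where r: "r \<in> J" "?p (T s (T r f) - k) < e / M"
      by auto
    have "?p (T t f - k) < e" if t: "t \<in> J" "s + r < t" for t
    proof -
      have u: "t - (s + r) \<in> J"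
        using add[OF s(1) r(1)] t shift by blast
      have "T t f - k = T (t - (s + r)) (T s (T r f) - k)"
        using sgD[OF add[OF s(1) r(1)] u, of f] sgD[OF r(1) s(1), of f] fix_k[OF u]
        by (simp add: blinfun.diff_right)
      then have "?p (T t f - k) \<le> M * ?p (T s (T r f) - k)"
        using contr[OF u] by simp
      also have "\<dots> < e"
        using r(2) M(1) by (simp add: field_simps)
      finally show ?thesis .
    qed
    then show "\<forall>\<^sub>F t in at_top_in J. ?p (T t f - k) < e"
      unfolding eventually_at_top_in by (intro exI[of _ "s + r + 1"]) auto
  qed
  moreover have "\<forall>\<^sub>F t in at_top_in J. T t f \<in> K"
    unfolding eventually_at_top_in K_def using closure_subset by fast
  ultimately have "((\<lambda>t. T t f) \<longlongrightarrow> k) (at_top_in J)"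
    using K(1)
    by (intro tendsto_if_compact_and_separating[where q = "\<lambda>x. ?p (x - k)" and K = K]
        continuous_on_abs_functional continuous_intros abs_functional_pos \<psi>) simp_all
  then show ?thesis
    by blast
qed


section \<open>Strong convergence\<close>

theorem proposition6p6:
  fixes J :: "real set"
    and T :: "real \<Rightarrow> 'a::order_continuous_banach_lattice \<Rightarrow>\<^sub>L 'a"
    and \<psi> :: "'a \<Rightarrow>\<^sub>L real"
  assumes "J = real ` {1..} \<or> J = {0<..}"
    and "semigroup_on J T"
    and "positive_on J T"
    and "dual_le 0 \<psi>"
    and "strictly_positive \<psi>"
    and "\<exists>M>0. \<forall>t\<in>J. dual_le (dual_op (T t) \<psi>) (M *\<^sub>R \<psi>)"
    and "relatively_compact_orbits J T"
    and "\<exists>h. (\<forall>f. 0 \<le> f \<and> blinfun_apply \<psi> f = 1 \<longrightarrow> h f \<noteq> 0 \<and> lower_bound_wrt J T \<psi> f (h f)) \<and>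
           (INF f\<in>{f. 0 \<le> f \<and> blinfun_apply \<psi> f = 1}. ereal (blinfun_apply \<psi> (h f))) \<ge> 1"
  shows "strongly_convergent_on J T"
proof -
  have add: "s + t \<in> J" if "s \<in> J" "t \<in> J" for s t
    using assms(1) that by (auto simp flip: of_nat_add)
  have shift: "t - s \<in> J" if "s \<in> J" "t \<in> J" "s < t" for s t
    using assms(1) that by (auto simp flip: of_nat_diff)
  have unbounded: "\<exists>t\<in>J. N \<le> t" for N
    using assms(1)
  proof
    assume "J = real ` {1..}"
    moreover obtain n :: nat where "N \<le> n"
      using real_arch_simple by blast
    ultimately show ?thesis
      by (intro bexI[of _ "real (max 1 n)"]) auto
  next
    assume "J = {0<..}"
    then show ?thesis
      by (intro bexI[of _ "max 1 N"]) auto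
  qed
  have nontrivial: "at_top_in J \<noteq> bot"
    using unbounded by (auto simp: trivial_limit_def eventually_at_top_in)
  obtain M where M: "0 < M" "\<And>t. t \<in> J \<Longrightarrow> dual_le (dual_op (T t) \<psi>) (M *\<^sub>R \<psi>)"
    using assms(6) by blast
  obtain h where h: "\<And>f. 0 \<le> f \<Longrightarrow> \<psi> f = 1 \<Longrightarrow> lower_bound_wrt J T \<psi> f (h f)"
    and inf: "1 \<le> (INF f\<in>{f. 0 \<le> f \<and> blinfun_apply \<psi> f = 1}. ereal (blinfun_apply \<psi> (h f)))"
    using assms(8) by blast
  have lower: "\<exists>h. lower_bound_wrt J T \<psi> f h \<and> 1 \<le> \<psi> h" if "0 \<le> f" "\<psi> f = 1" for f
  proof -
    have "1 \<le> ereal (\<psi> (h f))"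
      using that by (intro order_trans[OF inf INF_lower]) simp
    with h[OF that] show ?thesis
      by auto
  qed
  have pos_conv: "\<exists>k. ((\<lambda>t. T t f) \<longlongrightarrow> k) (at_top_in J)" if "0 \<le> f" for f
    by (rule orbit_convergent[OF add shift unbounded assms(2,3,5) M assms(7) lower that])
  have "\<exists>k. ((\<lambda>t. T t f) \<longlongrightarrow> k) (at_top_in J)" for f
  proof -
    have "0 \<le> pprt f" "0 \<le> - nprt f"
      by simp_all
    then obtain k l where "((\<lambda>t. T t (pprt f)) \<longlongrightarrow> k) (at_top_in J)"
      and "((\<lambda>t. T t (- nprt f)) \<longlongrightarrow> l) (at_top_in J)"
      using pos_conv by blast
    then have "((\<lambda>t. T t (pprt f) - T t (- nprt f)) \<longlongrightarrow> k - l) (at_top_in J)"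
      by (rule tendsto_diff)
    moreover have "T t (pprt f) - T t (- nprt f) = T t f" for t
      using prts[of f] by (metis blinfun.diff_right diff_minus_eq_add)
    ultimately show ?thesis
      by auto
  qed
  then obtain S where S: "\<And>f. ((\<lambda>t. T t f) \<longlongrightarrow> S f) (at_top_in J)"
    by metis
  have "linear S"
  proof (rule linearI)
    fix x y and c :: real
    have "((\<lambda>t. T t (x + y)) \<longlongrightarrow> S x + S y) (at_top_in J)"
      using tendsto_add[OF S S] by (simp add: blinfun.add_right)
    then show "S (x + y) = S x + S y"
      using S tendsto_unique[OF nontrivial] by blast
    have "((\<lambda>t. T t (c *\<^sub>R x)) \<longlongrightarrow> c *\<^sub>R S x) (at_top_in J)"
      using tendsto_scaleR[OF tendsto_const S] by (simp add: blinfun.scaleR_right)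
    then show "S (c *\<^sub>R x) = c *\<^sub>R S x"
      using S tendsto_unique[OF nontrivial] by blast
  qed
  moreover have "0 \<le> S x" if "0 \<le> x" for x
  proof -
    have "S x \<in> {x. 0 \<le> x}"
    proof (rule Lim_in_closed_set[OF closed_positive_cone _ nontrivial S])
      show "\<forall>\<^sub>F t in at_top_in J. T t x \<in> {x. 0 \<le> x}"
        using assms(3) that by (auto simp: eventually_at_top_in positive_on_def)
    qed
    then show ?thesis
      by simp
  qed
  ultimately have "bounded_linear S"
    by (rule bounded_linear_if_positive)
  then have "blinfun_apply (Blinfun S) = S"
    by (rule bounded_linear_Blinfun_apply)
  with S show ?thesis
    unfolding strongly_convergent_on_def by metis
qed

end
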